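(* Let $D\subseteq\mathbb{C}$ be a domain and let $\mathcal{F}$ be a family of holomorphic functions on $D$. Suppose that $F(\mathcal{F})$ and $J(\mathcal{F})$ are forward invariant under $\mathcal{F}$. Then the restriction of $\mathcal{F}$ to $J(\mathcal{F})$ is topologically transitive with respect to $J(\mathcal{F})$; that is, for all non-empty relatively open subsets $G$ and $V$ of $J(\mathcal{F})$ there exists $f\in\mathcal{F}$ with $f(G)\cap V\neq\emptyset$.
   Context: $\mathcal{F}$ is normal on an open set $W \subseteq D$ if every sequence in $\mathcal{F}$ contains a subsequence that converges locally uniformly on $W$ (with respect to the spherical metric, so that the limit $\infty$ is allowed), and normal at a point $z\in D$ if it is normal in some neighborhood of $z$ in $D$. $F(\mathcal{F})$ is the subset of $D$ on which $\mathcal{F}$ is normal, i.e. the set of points of $D$ at which $\mathcal{F}$ is normal, and $J(\mathcal{F}) := D\setminus F(\mathcal{F})$. A subset $E\subseteq D$ is forward invariant under $\mathcal{F}$ if $f(E)\subseteq E$ for all $f\in\mathcal{F}$. *)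

theory Defs
  imports "HOL-Complex_Analysis.Complex_Analysis"
begin

datatype riemann_sphere = Finite complex | Infinity

text \<open>
  Inverse stereographic projection from the north pole \<open>(0, 1)\<close> onto the unit sphere of
  \<open>\<complex> \<times> \<real>\<close>; the equatorial plane is the finite plane.
\<close>

fun stereo :: "riemann_sphere \<Rightarrow> complex \<times> real" where
  "stereo (Finite z) =
     ((2 / (1 + (cmod z)\<^sup>2)) *\<^sub>R z, ((cmod z)\<^sup>2 - 1) / ((cmod z)\<^sup>2 + 1))"
| "stereo Infinity = (0, 1)"

lemma norm_stereo [simp]: "norm (stereo p) = 1"
proof (cases p)
  case (Finite z)
  define s where "s = (cmod z)\<^sup>2"
  have s: "s \<ge> 0" by (simp add: s_def)
  have "(2 / (1 + s) * cmod z)\<^sup>2 + ((s - 1) / (s + 1))\<^sup>2 = (4 * s + (s - 1)\<^sup>2) / (s + 1)\<^sup>2"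
    by (simp add: s_def power_mult_distrib power_divide add_divide_distrib add.commute)
  also have "4 * s + (s - 1)\<^sup>2 = (s + 1)\<^sup>2"
    by (simp add: power2_eq_square algebra_simps)
  finally have "(2 / (1 + s) * cmod z)\<^sup>2 + ((s - 1) / (s + 1))\<^sup>2 = 1"
    using s by (simp add: add_nonneg_eq_0_iff del: times_divide_eq_left)
  then show ?thesis using s Finite
    by (simp add: norm_prod_def s_def[symmetric] power_divide)
qed (simp add: norm_prod_def)

lemma inj_stereo: "stereo p = stereo q \<Longrightarrow> p = q"
proof -
  have *: "((cmod z)\<^sup>2 - 1) / ((cmod z)\<^sup>2 + 1) = 1 - 2 / (1 + (cmod z)\<^sup>2)" for z
    by (simp add: field_simps add_nonneg_eq_0_iff)
  have nz: "2 / (1 + (cmod z)\<^sup>2) \<noteq> 0" for z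
    by (simp add: add_nonneg_eq_0_iff)
  show "stereo p = stereo q \<Longrightarrow> p = q"
    using nz by (cases p; cases q) (auto simp: * simp del: divide_eq_0_iff)
qed

lemma arccos_inner_triangle:
  fixes a b c :: "'a::real_inner"
  assumes "norm a = 1" "norm b = 1" "norm c = 1"
  shows "arccos (a \<bullet> c) \<le> arccos (a \<bullet> b) + arccos (b \<bullet> c)"
proof -
  have ab: "\<bar>a \<bullet> b\<bar> \<le> 1" and bc: "\<bar>b \<bullet> c\<bar> \<le> 1" and ac: "\<bar>a \<bullet> c\<bar> \<le> 1"
    using Cauchy_Schwarz_ineq2[of a b] Cauchy_Schwarz_ineq2[of b c] Cauchy_Schwarz_ineq2[of a c]
      assms by simp_all
  have sq: "a \<bullet> a = 1" "b \<bullet> b = 1" "c \<bullet> c = 1"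
    using assms by (simp_all add: norm_eq_1)
  define x where "x = arccos (a \<bullet> b)"
  define y where "y = arccos (b \<bullet> c)"
  have x: "0 \<le> x" "x \<le> pi" "cos x = a \<bullet> b" and y: "0 \<le> y" "y \<le> pi" "cos y = b \<bullet> c"
    using ab bc by (auto simp: x_def y_def arccos_lbound arccos_ubound cos_arccos_abs abs_le_iff)
  show ?thesis
  proof (cases "x + y \<le> pi")
    case True
    define u where "u = a - (a \<bullet> b) *\<^sub>R b"
    define v where "v = c - (b \<bullet> c) *\<^sub>R b"
    have "u \<bullet> u = 1 - (a \<bullet> b)\<^sup>2"
      by (simp add: u_def inner_diff_left inner_diff_right inner_commute sq power2_eq_square)
    then have nu: "norm u = sin x"
      using x sin_cos_squared_add[of x] sin_ge_zero[of x]
      by (simp add: norm_eq_sqrt_inner real_sqrt_unique)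
    have "v \<bullet> v = 1 - (b \<bullet> c)\<^sup>2"
      by (simp add: v_def inner_diff_left inner_diff_right inner_commute sq power2_eq_square)
    then have nv: "norm v = sin y"
      using y sin_cos_squared_add[of y] sin_ge_zero[of y]
      by (simp add: norm_eq_sqrt_inner real_sqrt_unique)
    have uv: "u \<bullet> v = a \<bullet> c - (a \<bullet> b) * (b \<bullet> c)"
      by (simp add: u_def v_def inner_diff_left inner_diff_right inner_commute sq)
    have "cos (x + y) \<le> a \<bullet> c"
      using Cauchy_Schwarz_ineq2[of u v] by (simp add: nu nv uv cos_add x y)
    also have "a \<bullet> c = cos (arccos (a \<bullet> c))"
      using ac by (simp add: cos_arccos_abs)
    finally have "arccos (a \<bullet> c) \<le> x + y"
      using True x y ac
      by (subst (asm) cos_mono_le_eq) (auto simp: arccos_lbound arccos_ubound abs_le_iff)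
    then show ?thesis by (simp add: x_def y_def)
  next
    case False
    moreover have "arccos (a \<bullet> c) \<le> pi"
      using ac by (intro arccos_ubound) (auto simp: abs_le_iff)
    ultimately show ?thesis by (simp add: x_def y_def)
  qed
qed

instantiation riemann_sphere :: metric_space
begin

text \<open>The spherical metric: great-circle distance of the images on the unit sphere.\<close>

definition dist_riemann_sphere :: "riemann_sphere \<Rightarrow> riemann_sphere \<Rightarrow> real" where
  "dist_riemann_sphere p q = arccos (stereo p \<bullet> stereo q)"

definition uniformity_riemann_sphere :: "(riemann_sphere \<times> riemann_sphere) filter" where
  "uniformity_riemann_sphere = (INF e\<in>{0 <..}. principal {(x, y). dist x y < e})"

definition open_riemann_sphere :: "riemann_sphere set \<Rightarrow> bool" where
  "open_riemann_sphere U =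
     (\<forall>x\<in>U. eventually (\<lambda>(x', y). x' = x \<longrightarrow> y \<in> U) uniformity)"

instance
proof
  fix p q r :: riemann_sphere
  have le1: "\<bar>stereo p \<bullet> stereo q\<bar> \<le> 1" for p q
    using Cauchy_Schwarz_ineq2[of "stereo p" "stereo q"] by simp
  show "dist p q = 0 \<longleftrightarrow> p = q"
  proof
    assume "dist p q = 0"
    then have "stereo p \<bullet> stereo q = 1"
      using cos_arccos_abs[OF le1, of p q] by (simp add: dist_riemann_sphere_def)
    then have "stereo p \<bullet> stereo q = norm (stereo p) * norm (stereo q)"
      by simp
    then have "stereo p = stereo q"
      by (subst (asm) norm_cauchy_schwarz_eq) simp
    then show "p = q" by (rule inj_stereo)
  next
    assume "p = q"
    moreover have "stereo q \<bullet> stereo q = 1"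
      using norm_stereo[of q] by (simp only: norm_eq_1)
    ultimately show "dist p q = 0" by (simp add: dist_riemann_sphere_def)
  qed
  show "dist p q \<le> dist p r + dist q r"
    using arccos_inner_triangle[of "stereo p" "stereo r" "stereo q"]
    by (simp add: dist_riemann_sphere_def inner_commute)
qed (simp_all only: uniformity_riemann_sphere_def open_riemann_sphere_def)

end

definition locally_uniform_limit ::
  "complex set \<Rightarrow> (nat \<Rightarrow> complex \<Rightarrow> riemann_sphere) \<Rightarrow> (complex \<Rightarrow> riemann_sphere) \<Rightarrow> bool" where
  "locally_uniform_limit W f g \<longleftrightarrow>
     (\<forall>z\<in>W. \<exists>U. open U \<and> z \<in> U \<and> U \<subseteq> W \<and> uniform_limit U f g sequentially)"

definition normal_family_on :: "(complex \<Rightarrow> complex) set \<Rightarrow> complex set \<Rightarrow> bool" where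
  "normal_family_on \<F> W \<longleftrightarrow>
     (\<forall>f :: nat \<Rightarrow> complex \<Rightarrow> complex. range f \<subseteq> \<F> \<longrightarrow>
        (\<exists>r g. strict_mono r \<and> locally_uniform_limit W (\<lambda>n z. Finite (f (r n) z)) g))"

definition normal_family_at ::
  "complex set \<Rightarrow> (complex \<Rightarrow> complex) set \<Rightarrow> complex \<Rightarrow> bool" where
  "normal_family_at D \<F> z \<longleftrightarrow> (\<exists>W. open W \<and> z \<in> W \<and> W \<subseteq> D \<and> normal_family_on \<F> W)"

definition fatou_set :: "complex set \<Rightarrow> (complex \<Rightarrow> complex) set \<Rightarrow> complex set" where
  "fatou_set D \<F> = {z \<in> D. normal_family_at D \<F> z}"

definition julia_set :: "complex set \<Rightarrow> (complex \<Rightarrow> complex) set \<Rightarrow> complex set" where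
  "julia_set D \<F> = D - fatou_set D \<F>"

definition forward_invariant :: "(complex \<Rightarrow> complex) set \<Rightarrow> complex set \<Rightarrow> bool" where
  "forward_invariant \<F> E \<longleftrightarrow> (\<forall>f\<in>\<F>. f ` E \<subseteq> E)"

definition topologically_transitive_on :: "(complex \<Rightarrow> complex) set \<Rightarrow> complex set \<Rightarrow> bool" where
  "topologically_transitive_on \<F> J \<longleftrightarrow>
     (\<forall>G V. openin (top_of_set J) G \<and> G \<noteq> {} \<and> openin (top_of_set J) V \<and> V \<noteq> {} \<longrightarrow>
        (\<exists>f\<in>\<F>. f ` G \<inter> V \<noteq> {}))"

end

theory Submission
  imports Defs
begin

text \<open>
  Suppose that no \<open>f \<in> \<F>\<close> maps a point of \<open>G\<close> into \<open>V\<close>, and let \<open>A\<close> be an open set that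
  cuts \<open>G\<close> out of the Julia set. Members of \<open>\<F>\<close> map Fatou points to Fatou points, and these
  lie outside \<open>V\<close>. So the whole family omits \<open>V\<close> on all of \<open>A \<inter> D\<close>, not only on \<open>G\<close>. If
  \<open>V\<close> has two points, Montel's criterion makes the family normal on a disc around a point of
  \<open>G\<close>, which contradicts that this point belongs to the Julia set.

  If \<open>V\<close> is a single point \<open>p\<close>, then \<open>p\<close> is isolated in the Julia set, and this forces the
  Julia set to be \<open>{p}\<close> (lemma \<open>isolated_julia_point_unique\<close>); then \<open>G = V\<close>, and
  transitivity is immediate from invariance. For the reason, let \<open>q \<noteq> p\<close> be a second Julia
  point and take a disc around \<open>p\<close> without further Julia points. By invariance of the Fatou
  set, on this disc every \<open>f \<in> \<F>\<close> takes Julia values at most at the centre \<open>p\<close>. Since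
  \<open>f p\<close> cannot equal both \<open>p\<close> and \<open>q\<close>, the function \<open>f\<close> omits one of these two values and
  takes the other at most once.

  Both cases thus rest on one strengthening of Montel's criterion (lemma
  \<open>normal_family_omit_once\<close>): holomorphic functions on a disc that omit a value \<open>a\<close> and take
  a value \<open>b \<noteq> a\<close> at most once are normal. Normalise \<open>a = 0\<close>, \<open>b = 1\<close>. Such a function \<open>k\<close>
  has a holomorphic square root, and since \<open>k = 1\<close> holds at most at one point, one of the
  two roots omits \<open>1\<close> as well as \<open>0\<close>. Schottky's theorem bounds this root or its reciprocal
  near the centre, uniformly in \<open>k\<close>, and squaring gives the same for \<open>k\<close>. Bounded
  holomorphic functions have convergent subsequences, and a continuous map from the plane to
  the sphere carries the convergence over to the original functions.
\<close>

section \<open>Continuity of projective coordinates on the sphere\<close>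

text \<open>
  The point \<open>[u : v]\<close> of the complex projective line. Allowing \<open>v = 0\<close> treats the passages
  \<open>w \<mapsto> a + c w\<close> and \<open>w \<mapsto> a + c / w\<close> to the sphere in the same way.
\<close>

definition ratio :: "complex \<Rightarrow> complex \<Rightarrow> riemann_sphere" where
  "ratio u v = (if v = 0 then Infinity else Finite (u / v))"

text \<open>
  Clearing denominators turns stereographic projection into a formula that has no exceptional
  case at \<open>Infinity\<close>, so that its continuity there can be read off.
\<close>

lemma stereo_ratio:
  assumes "u \<noteq> 0 \<or> v \<noteq> 0"
  shows "stereo (ratio u v) =
     ((2 / ((cmod u)\<^sup>2 + (cmod v)\<^sup>2)) *\<^sub>R (u * cnj v),
      ((cmod u)\<^sup>2 - (cmod v)\<^sup>2) / ((cmod u)\<^sup>2 + (cmod v)\<^sup>2))"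
proof (cases "v = 0")
  case True
  then show ?thesis using assms by (simp add: ratio_def)
next
  case False
  define s where "s = (cmod u)\<^sup>2"
  define t where "t = (cmod v)\<^sup>2"
  have st: "s \<ge> 0" "t > 0" using False by (simp_all add: s_def t_def)
  have "(cmod (u / v))\<^sup>2 = s / t"
    by (simp add: norm_divide power_divide s_def t_def)
  then have "stereo (ratio u v) = ((2 / (1 + s / t)) *\<^sub>R (u / v), (s / t - 1) / (s / t + 1))"
    using False by (simp add: ratio_def)
  also have "u / v = (1 / t) *\<^sub>R (u * cnj v)"
    unfolding t_def using False by (simp add: complex_div_cnj[of u v] scaleR_conv_of_real)
  also have "(2 / (1 + s / t)) *\<^sub>R (1 / t) *\<^sub>R (u * cnj v) = (2 / (s + t)) *\<^sub>R (u * cnj v)"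
  proof -
    have "2 / (1 + s / t) * (1 / t) = 2 / (s + t)"
      using st by (simp add: divide_simps)
    then show ?thesis by (simp only: scaleR_scaleR)
  qed
  also have "(s / t - 1) / (s / t + 1) = (s - t) / (s + t)"
    using st by (simp add: divide_simps)
  finally show ?thesis by (simp only: s_def t_def)
qed

lemma continuous_on_ratio:
  fixes u v :: "complex \<Rightarrow> complex"
  assumes u: "continuous_on A u" and v: "continuous_on A v"
    and nz: "\<And>w. w \<in> A \<Longrightarrow> u w \<noteq> 0 \<or> v w \<noteq> 0"
  shows "continuous_on A (\<lambda>w. ratio (u w) (v w))"
proof -
  have pos: "(cmod (u w))\<^sup>2 + (cmod (v w))\<^sup>2 \<noteq> 0" if "w \<in> A" for w
    using nz[OF that] by (simp add: sum_power2_eq_zero_iff)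
  have "continuous_on A (\<lambda>w. ((2 / ((cmod (u w))\<^sup>2 + (cmod (v w))\<^sup>2)) *\<^sub>R (u w * cnj (v w)),
      ((cmod (u w))\<^sup>2 - (cmod (v w))\<^sup>2) / ((cmod (u w))\<^sup>2 + (cmod (v w))\<^sup>2)))"
    using pos by (intro continuous_intros u v) auto
  then have st: "continuous_on A (\<lambda>w. stereo (ratio (u w) (v w)))"
    by (rule continuous_on_eq) (simp only: stereo_ratio[OF nz])
  show ?thesis
    unfolding continuous_on
  proof
    fix a assume a: "a \<in> A"
    have le1: "\<bar>stereo p \<bullet> stereo q\<bar> \<le> 1" for p q
      using Cauchy_Schwarz_ineq2[of "stereo p" "stereo q"] by simp
    have unit: "stereo p \<bullet> stereo p = 1" for p
      using norm_stereo[of p] by (simp only: norm_eq_1)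
    have "continuous_on A (\<lambda>w. arccos (stereo (ratio (u w) (v w)) \<bullet> stereo (ratio (u a) (v a))))"
      using le1
      by (intro continuous_on_compose2[OF continuous_on_arccos'] continuous_intros st)
         (auto simp: abs_le_iff minus_le_iff)
    then have "((\<lambda>w. dist (ratio (u w) (v w)) (ratio (u a) (v a))) \<longlongrightarrow> 0) (at a within A)"
      using a unit unfolding continuous_on dist_riemann_sphere_def by fastforce
    then show "((\<lambda>w. ratio (u w) (v w)) \<longlongrightarrow> ratio (u a) (v a)) (at a within A)"
      using tendsto_dist_iff by blast
  qed
qed

section \<open>Criteria for normality\<close>

text \<open>
  A sequence in the union has infinitely many members in one of the two families. This is what
  permits a separate argument for the bounded functions and for those with bounded reciprocal.
\<close>

lemma normal_family_on_Un:
  assumes "normal_family_on \<F> W" and "normal_family_on \<G> W"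
  shows "normal_family_on (\<F> \<union> \<G>) W"
  unfolding normal_family_on_def
proof (intro allI impI)
  fix f :: "nat \<Rightarrow> complex \<Rightarrow> complex"
  assume rf: "range f \<subseteq> \<F> \<union> \<G>"
  have sub: "\<exists>r g. strict_mono r \<and> locally_uniform_limit W (\<lambda>n z. Finite (f (r n) z)) g"
    if inf: "infinite {n. f n \<in> \<H>}" and nor: "normal_family_on \<H> W" for \<H>
  proof -
    obtain s :: "nat \<Rightarrow> nat" where s: "strict_mono s" "\<And>n. f (s n) \<in> \<H>"
      using infinite_enumerate[OF inf] by auto
    then have "range (\<lambda>n. f (s n)) \<subseteq> \<H>" by auto
    then obtain r g where "strict_mono r"
      "locally_uniform_limit W (\<lambda>n z. Finite (f (s (r n)) z)) g"
      using nor unfolding normal_family_on_def by meson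
    then show ?thesis
      using strict_mono_o[OF s(1)] by (intro exI[of _ "s \<circ> r"] exI[of _ g]) auto
  qed
  have "{n. f n \<in> \<F>} \<union> {n. f n \<in> \<G>} = UNIV" using rf by auto
  then have "infinite {n. f n \<in> \<F>} \<or> infinite {n. f n \<in> \<G>}"
    by (metis finite_Un infinite_UNIV_nat)
  then show "\<exists>r g. strict_mono r \<and> locally_uniform_limit W (\<lambda>n z. Finite (f (r n) z)) g"
    using sub assms by blast
qed

lemma normal_family_on_subset:
  assumes "normal_family_on \<G> W" and "\<F> \<subseteq> \<G>"
  shows "normal_family_on \<F> W"
  using assms unfolding normal_family_on_def by (meson subset_trans)

lemma normal_family_on_mono:
  assumes "normal_family_on \<F> W" and "V \<subseteq> W" and "open V"
  shows "normal_family_on \<F> V"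
proof -
  have "locally_uniform_limit V f g" if lim: "locally_uniform_limit W f g" for f g
    unfolding locally_uniform_limit_def
  proof
    fix z assume "z \<in> V"
    then obtain U where "open U" "z \<in> U" "uniform_limit U f g sequentially"
      using lim assms(2) unfolding locally_uniform_limit_def by blast
    then show "\<exists>U. open U \<and> z \<in> U \<and> U \<subseteq> V \<and> uniform_limit U f g sequentially"
      using \<open>z \<in> V\<close> \<open>open V\<close>
      by (intro exI[of _ "U \<inter> V"]) (auto intro: uniform_limit_on_subset)
  qed
  then show ?thesis
    using assms(1) unfolding normal_family_on_def by meson
qed

text \<open>
  Montel's theorem for bounded functions is about Euclidean convergence of finite values. A
  continuous \<open>\<phi>\<close> is uniformly continuous on the compact disc that contains all values \<open>h z\<close>, so
  it turns Euclidean locally uniform convergence of the \<open>h\<close> into spherical convergence of the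
  \<open>f\<close>. With \<open>\<phi> w = a + c / w\<close> the limit \<open>\<infinity>\<close> of the \<open>f\<close> becomes the ordinary limit \<open>0\<close> of
  the \<open>h\<close>.
\<close>

lemma normal_family_on_bounded_lift:
  fixes \<phi> :: "complex \<Rightarrow> riemann_sphere"
  assumes "open W" and \<phi>: "continuous_on (cball 0 M) \<phi>"
    and fac: "\<And>f. f \<in> \<F> \<Longrightarrow> \<exists>h. h holomorphic_on W \<and>
                (\<forall>z\<in>W. cmod (h z) \<le> M \<and> Finite (f z) = \<phi> (h z))"
  shows "normal_family_on \<F> W"
  unfolding normal_family_on_def
proof (intro allI impI)
  fix f :: "nat \<Rightarrow> complex \<Rightarrow> complex"
  assume "range f \<subseteq> \<F>"
  then have "\<forall>n. \<exists>h. h holomorphic_on W \<and> (\<forall>z\<in>W. cmod (h z) \<le> M \<and> Finite (f n z) = \<phi> (h z))"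
    using fac by blast
  then obtain h where h: "\<And>n. h n holomorphic_on W" "\<And>n z. z \<in> W \<Longrightarrow> cmod (h n z) \<le> M"
      "\<And>n z. z \<in> W \<Longrightarrow> Finite (f n z) = \<phi> (h n z)"
    by metis
  obtain g r where r: "strict_mono (r :: nat \<Rightarrow> nat)"
      and g: "\<And>K. \<lbrakk>compact K; K \<subseteq> W\<rbrakk> \<Longrightarrow> uniform_limit K (h \<circ> r) g sequentially"
  proof (rule Montel[of W "range h" h])
    show "\<exists>B. \<forall>k\<in>range h. \<forall>z\<in>K. cmod (k z) \<le> B" if "K \<subseteq> W" for K
      using that h(2) by (intro exI[of _ M]) auto
  qed (use \<open>open W\<close> h(1) in auto)
  have uc: "uniformly_continuous_on (cball 0 M) \<phi>"
    using \<phi> by (intro compact_uniformly_continuous) auto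
  have "locally_uniform_limit W (\<lambda>n z. Finite (f (r n) z)) (\<lambda>z. \<phi> (g z))"
    unfolding locally_uniform_limit_def
  proof
    fix z assume "z \<in> W"
    then obtain e where e: "e > 0" "cball z e \<subseteq> W"
      using \<open>open W\<close> open_contains_cball by blast
    have "uniform_limit (cball z e) (\<lambda>n z. \<phi> ((h \<circ> r) n z)) (\<lambda>z. \<phi> (g z)) sequentially"
      by (rule uniform_limit_compose_uniformly_continuous_on[OF g uc])
         (use e h(2) in \<open>auto intro!: always_eventually simp: subset_iff\<close>)
    moreover have "\<phi> ((h \<circ> r) n x) = Finite (f (r n) x)" if "x \<in> cball z e" for n x
      using that e(2) h(3)[of x "r n"] by auto
    ultimately have "uniform_limit (cball z e) (\<lambda>n z. Finite (f (r n) z)) (\<lambda>z. \<phi> (g z)) sequentially"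
      by (subst (asm) uniform_limit_cong'[where g = "\<lambda>n z. Finite (f (r n) z)" and i = "\<lambda>z. \<phi> (g z)"]) auto
    then have "uniform_limit (ball z e) (\<lambda>n z. Finite (f (r n) z)) (\<lambda>z. \<phi> (g z)) sequentially"
      by (rule uniform_limit_on_subset) (rule ball_subset_cball)
    moreover have "ball z e \<subseteq> W" using e(2) ball_subset_cball by blast
    ultimately show "\<exists>U. open U \<and> z \<in> U \<and> U \<subseteq> W \<and>
        uniform_limit U (\<lambda>n z. Finite (f (r n) z)) (\<lambda>z. \<phi> (g z)) sequentially"
      using e(1) by (intro exI[of _ "ball z e"]) auto
  qed
  with r show "\<exists>r g. strict_mono r \<and> locally_uniform_limit W (\<lambda>n z. Finite (f (r n) z)) g"
    by blast
qed

section \<open>Functions with an omitted value and a value taken at most once\<close>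

text \<open>
  Schottky's theorem bounds all those functions with \<open>\<bar>k p\<bar> \<le> 1\<close> near \<open>p\<close>. The reciprocals
  of the others omit \<open>0\<close> and \<open>1\<close> too and satisfy the same condition at \<open>p\<close>. Only the
  neighbourhood and the bound, and not the choice of alternative, are uniform in \<open>k\<close>.
\<close>

lemma omit_0_1_bounded_dichotomy:
  assumes "open S" "connected S" "p \<in> S"
  obtains W M where "open W" "p \<in> W" "W \<subseteq> S"
    "\<forall>k. k holomorphic_on S \<and> 0 \<notin> k ` S \<and> 1 \<notin> k ` S \<longrightarrow>
       (\<forall>z\<in>W. cmod (k z) \<le> M) \<or> (\<forall>z\<in>W. cmod (inverse (k z)) \<le> M)"
proof -
  define X where "X = {k. k holomorphic_on S \<and> 0 \<notin> k ` S \<and> 1 \<notin> k ` S}"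
  have X: "h holomorphic_on S" "z \<in> S \<Longrightarrow> h z \<noteq> 0 \<and> h z \<noteq> 1" if "h \<in> X" for h z
    using that unfolding X_def by (blast, force)
  obtain B Z where BZ: "open Z" "p \<in> Z" "Z \<subseteq> S"
      "\<And>h z. h \<in> {h \<in> X. cmod (h p) \<le> 1} \<Longrightarrow> z \<in> Z \<Longrightarrow> cmod (h z) \<le> B"
    by (rule GPicard1[OF assms zero_less_one, where X = X and Y = "{h \<in> X. cmod (h p) \<le> 1}"])
       (use X in auto)
  have "(\<forall>z\<in>Z. cmod (k z) \<le> B) \<or> (\<forall>z\<in>Z. cmod (inverse (k z)) \<le> B)"
    if k: "k holomorphic_on S" "0 \<notin> k ` S" "1 \<notin> k ` S" for k
  proof (cases "cmod (k p) \<le> 1")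
    case True
    then have "k \<in> {h \<in> X. cmod (h p) \<le> 1}" using k unfolding X_def by blast
    then show ?thesis using BZ(4) by blast
  next
    case False
    have "(\<lambda>z. inverse (k z)) holomorphic_on S"
      using k by (intro holomorphic_intros) auto
    moreover have "cmod (inverse (k p)) \<le> 1"
      using False by (simp add: norm_inverse inverse_le_1_iff)
    ultimately have "(\<lambda>z. inverse (k z)) \<in> {h \<in> X. cmod (h p) \<le> 1}"
      using k unfolding X_def by (auto simp: image_iff inverse_eq_1_iff)
    then show ?thesis using BZ(4) by blast
  qed
  then show thesis using that[OF BZ(1-3)] by blast
qed

text \<open>
  The two square roots of \<open>k\<close> take opposite values, so the value \<open>1\<close> of one root and the value
  \<open>1\<close> of the other occur at different points, both with \<open>k = 1\<close>. Hence one root omits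
  \<open>1\<close>, and the preceding lemma applies to it.
\<close>

lemma omit_0_once_1_bounded_dichotomy:
  assumes S: "open S" "contractible S" "p \<in> S"
  obtains W M where "open W" "p \<in> W" "W \<subseteq> S"
    "\<forall>k. k holomorphic_on S \<and> 0 \<notin> k ` S \<and>
       (\<forall>x\<in>S. \<forall>y\<in>S. k x = 1 \<longrightarrow> k y = 1 \<longrightarrow> x = y) \<longrightarrow>
       (\<forall>z\<in>W. cmod (k z) \<le> M) \<or> (\<forall>z\<in>W. cmod (inverse (k z)) \<le> M)"
proof -
  obtain W M where W: "open W" "p \<in> W" "W \<subseteq> S"
    and M: "\<forall>k. k holomorphic_on S \<and> 0 \<notin> k ` S \<and> 1 \<notin> k ` S \<longrightarrow>
       (\<forall>z\<in>W. cmod (k z) \<le> M) \<or> (\<forall>z\<in>W. cmod (inverse (k z)) \<le> M)"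
    by (rule omit_0_1_bounded_dichotomy[OF S(1) contractible_imp_connected[OF S(2)] S(3)])
       (rule that)
  have "(\<forall>z\<in>W. cmod (k z) \<le> M\<^sup>2) \<or> (\<forall>z\<in>W. cmod (inverse (k z)) \<le> M\<^sup>2)"
    if k: "k holomorphic_on S" "0 \<notin> k ` S"
      and once: "\<forall>x\<in>S. \<forall>y\<in>S. k x = 1 \<longrightarrow> k y = 1 \<longrightarrow> x = y" for k
  proof -
    obtain g where g: "g holomorphic_on S" "\<And>z. z \<in> S \<Longrightarrow> k z = (g z)\<^sup>2"
      using contractible_imp_holomorphic_sqrt[OF k(1) S(2)] k(2) by (metis image_eqI)
    have "\<exists>h. h holomorphic_on S \<and> (\<forall>z\<in>S. k z = (h z)\<^sup>2) \<and> 1 \<notin> h ` S"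
    proof (cases "1 \<in> g ` S")
      case False
      then show ?thesis using g by blast
    next
      case True
      then obtain x where x: "x \<in> S" "g x = 1" by auto
      have "g y \<noteq> -1" if "y \<in> S" for y
      proof
        assume "g y = -1"
        then have "k y = 1" "k x = 1" using g(2) that x by auto
        then have "x = y" using once that x(1) by blast
        then show False using x \<open>g y = -1\<close> by simp
      qed
      then have "1 \<notin> (\<lambda>z. - g z) ` S" by (metis (no_types, lifting) imageE minus_minus)
      moreover have "(\<lambda>z. - g z) holomorphic_on S" by (intro holomorphic_intros g)
      ultimately show ?thesis using g(2) by (intro exI[of _ "\<lambda>z. - g z"]) auto
    qed
    then obtain h where h: "h holomorphic_on S" "\<And>z. z \<in> S \<Longrightarrow> k z = (h z)\<^sup>2" "1 \<notin> h ` S"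
      by blast
    have "0 \<notin> h ` S" using h(2) k(2) by (force simp: image_iff)
    then have "(\<forall>z\<in>W. cmod (h z) \<le> M) \<or> (\<forall>z\<in>W. cmod (inverse (h z)) \<le> M)"
      using M h(1,3) by blast
    then show ?thesis
    proof
      assume "\<forall>z\<in>W. cmod (h z) \<le> M"
      then show ?thesis using h(2) W(3) by (auto simp: norm_power power_mono subset_iff)
    next
      assume "\<forall>z\<in>W. cmod (inverse (h z)) \<le> M"
      then have "\<forall>z\<in>W. cmod (inverse (h z)) ^ 2 \<le> M\<^sup>2" by (simp add: power_mono)
      then show ?thesis
        using h(2) W(3) by (auto simp: norm_inverse norm_power power_inverse subset_iff)
    qed
  qed
  then show thesis using that[OF W] by blast
qed

text \<open>
  Montel's criterion, with one of the two omitted values relaxed to a value taken at most once.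
  For \<open>k = (f - a) / (b - a)\<close> the family splits into the functions with \<open>k\<close> bounded and those
  with \<open>1 / k\<close> bounded.
\<close>

lemma normal_family_omit_once:
  assumes S: "open S" "contractible S" "p \<in> S" and "a \<noteq> b"
    and hol: "\<And>f. f \<in> \<F> \<Longrightarrow> f holomorphic_on S"
    and omit: "\<And>f. f \<in> \<F> \<Longrightarrow> a \<notin> f ` S"
    and once: "\<And>f x y. f \<in> \<F> \<Longrightarrow> x \<in> S \<Longrightarrow> y \<in> S \<Longrightarrow> f x = b \<Longrightarrow> f y = b \<Longrightarrow> x = y"
  obtains W where "open W" "p \<in> W" "W \<subseteq> S" "normal_family_on \<F> W"
proof -
  obtain W M where W: "open W" "p \<in> W" "W \<subseteq> S"
    and M: "\<forall>k. k holomorphic_on S \<and> 0 \<notin> k ` S \<and>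
       (\<forall>x\<in>S. \<forall>y\<in>S. k x = 1 \<longrightarrow> k y = 1 \<longrightarrow> x = y) \<longrightarrow>
       (\<forall>z\<in>W. cmod (k z) \<le> M) \<or> (\<forall>z\<in>W. cmod (inverse (k z)) \<le> M)"
    by (rule omit_0_once_1_bounded_dichotomy[OF S]) (rule that)
  define k where "k = (\<lambda>f z. ((f :: complex \<Rightarrow> complex) z - a) / (b - a))"
  have ba: "b - a \<noteq> 0" using \<open>a \<noteq> b\<close> by simp
  have f_eq: "f z = a + (b - a) * k f z" for f z
    using ba by (simp add: k_def)
  have holk: "k f holomorphic_on S" if "f \<in> \<F>" for f
    unfolding k_def using hol[OF that] ba by (intro holomorphic_intros)
  have k0: "k f z \<noteq> 0" if "f \<in> \<F>" "z \<in> S" for f z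
    using omit[OF that(1)] that(2) ba by (auto simp: k_def)
  have k1: "k f z = 1 \<longleftrightarrow> f z = b" for f z
    using ba by (simp add: k_def)
  define \<F>1 where "\<F>1 = {f \<in> \<F>. \<forall>z\<in>W. cmod (k f z) \<le> M}"
  define \<F>2 where "\<F>2 = {f \<in> \<F>. \<forall>z\<in>W. cmod (inverse (k f z)) \<le> M}"
  have "normal_family_on \<F>1 W"
  proof (rule normal_family_on_bounded_lift[OF W(1)])
    show "continuous_on (cball 0 M) (\<lambda>w. ratio (a + (b - a) * w) 1)"
      by (intro continuous_on_ratio continuous_intros) auto
    show "\<exists>h. h holomorphic_on W \<and>
        (\<forall>z\<in>W. cmod (h z) \<le> M \<and> Finite (f z) = ratio (a + (b - a) * h z) 1)"
      if "f \<in> \<F>1" for f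
      using that holk[of f] holomorphic_on_subset[OF _ W(3)] f_eq[of f]
      by (intro exI[of _ "k f"]) (auto simp: \<F>1_def ratio_def)
  qed
  moreover have "normal_family_on \<F>2 W"
  proof (rule normal_family_on_bounded_lift[OF W(1)])
    \<comment> \<open>From \<open>w = 1 / k\<close> the function is recovered as
       \<open>f = a + (b - a) / w = [a w + (b - a) : w]\<close>.\<close>
    show "continuous_on (cball 0 M) (\<lambda>w. ratio (a * w + (b - a)) w)"
      using ba by (intro continuous_on_ratio continuous_intros) auto
    show "\<exists>h. h holomorphic_on W \<and>
        (\<forall>z\<in>W. cmod (h z) \<le> M \<and> Finite (f z) = ratio (a * h z + (b - a)) (h z))"
      if "f \<in> \<F>2" for f
    proof (intro exI[of _ "\<lambda>z. inverse (k f z)"] conjI ballI)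
      have f: "f \<in> \<F>" using that by (simp add: \<F>2_def)
      show "(\<lambda>z. inverse (k f z)) holomorphic_on W"
        using holomorphic_on_subset[OF holk[OF f] W(3)] k0[OF f] W(3)
        by (intro holomorphic_intros) auto
      fix z assume z: "z \<in> W"
      show "cmod (inverse (k f z)) \<le> M" using that z by (simp add: \<F>2_def)
      have "k f z \<noteq> 0" using k0[OF f] z W(3) by blast
      then show "Finite (f z) = ratio (a * inverse (k f z) + (b - a)) (inverse (k f z))"
        unfolding ratio_def by (subst f_eq) (simp add: field_simps)
    qed
  qed
  ultimately have "normal_family_on (\<F>1 \<union> \<F>2) W"
    by (rule normal_family_on_Un)
  moreover have "\<F> \<subseteq> \<F>1 \<union> \<F>2"
  proof
    fix f assume f: "f \<in> \<F>"
    have "0 \<notin> k f ` S" using k0[OF f] by force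
    moreover have "\<forall>x\<in>S. \<forall>y\<in>S. k f x = 1 \<longrightarrow> k f y = 1 \<longrightarrow> x = y"
      using once[OF f] by (simp add: k1)
    ultimately have "(\<forall>z\<in>W. cmod (k f z) \<le> M) \<or> (\<forall>z\<in>W. cmod (inverse (k f z)) \<le> M)"
      using M holk[OF f] by blast
    then show "f \<in> \<F>1 \<union> \<F>2" using f by (auto simp: \<F>1_def \<F>2_def)
  qed
  ultimately show thesis
    using that[OF W] normal_family_on_subset by blast
qed

section \<open>Isolated points and transitivity\<close>

text \<open>
  If there were a second Julia point \<open>q\<close>, the functions with \<open>f p \<noteq> p\<close> would omit \<open>p\<close>, and
  those with \<open>f p \<noteq> q\<close> would omit \<open>q\<close>, on a small disc around \<open>p\<close>; these two classes exhaust
  \<open>\<F>\<close>, and each takes the other of the two values at most at \<open>p\<close>.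
\<close>

lemma isolated_julia_point_unique:
  assumes "open D" and hol: "\<And>f. f \<in> \<F> \<Longrightarrow> f holomorphic_on D"
    and invF: "forward_invariant \<F> (fatou_set D \<F>)"
    and p: "p \<in> julia_set D \<F>" and iso: "open B" "julia_set D \<F> \<inter> B = {p}"
  shows "julia_set D \<F> = {p}"
proof (rule ccontr)
  assume "julia_set D \<F> \<noteq> {p}"
  then obtain q where q: "q \<in> julia_set D \<F>" "q \<noteq> p" using p by blast
  have "open (B \<inter> D)" "p \<in> B \<inter> D"
    using \<open>open D\<close> iso p by (auto simp: julia_set_def)
  then obtain e where e: "e > 0" "ball p e \<subseteq> B \<inter> D"
    using open_contains_ball by blast
  have only_p: "z = p" if "f \<in> \<F>" "z \<in> ball p e" "f z \<in> julia_set D \<F>" for f z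
  proof (rule ccontr)
    assume "z \<noteq> p"
    then have "z \<in> fatou_set D \<F>"
      using that(2) e(2) iso(2) unfolding julia_set_def by blast
    then have "f z \<in> fatou_set D \<F>"
      using invF that(1) unfolding forward_invariant_def by blast
    then show False using that(3) by (simp add: julia_set_def)
  qed
  have normal: "\<exists>W. open W \<and> p \<in> W \<and> W \<subseteq> ball p e \<and> normal_family_on {f \<in> \<F>. f p \<noteq> a} W"
    if "a \<in> julia_set D \<F>" "b \<in> julia_set D \<F>" "a \<noteq> b" for a b
  proof -
    obtain W where "open W" "p \<in> W" "W \<subseteq> ball p e" "normal_family_on {f \<in> \<F>. f p \<noteq> a} W"
    proof (rule normal_family_omit_once[of "ball p e" p a b "{f \<in> \<F>. f p \<noteq> a}"])
      show "f holomorphic_on ball p e" if "f \<in> {f \<in> \<F>. f p \<noteq> a}" for f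
        using that hol e(2) holomorphic_on_subset by blast
      show "a \<notin> f ` ball p e" if "f \<in> {f \<in> \<F>. f p \<noteq> a}" for f
        using that only_p[of f] \<open>a \<in> julia_set D \<F>\<close> by blast
      show "x = y" if "f \<in> {f \<in> \<F>. f p \<noteq> a}" "x \<in> ball p e" "y \<in> ball p e" "f x = b" "f y = b"
        for f x y
        using only_p[of f x] only_p[of f y] that \<open>b \<in> julia_set D \<F>\<close> by simp
    qed (use e(1) \<open>a \<noteq> b\<close> in \<open>auto simp: convex_imp_contractible\<close>)
    then show ?thesis by blast
  qed
  obtain W1 where W1: "open W1" "p \<in> W1" "W1 \<subseteq> ball p e" "normal_family_on {f \<in> \<F>. f p \<noteq> p} W1"
    using normal[OF p q(1)] q(2) by blast
  obtain W2 where W2: "open W2" "p \<in> W2" "normal_family_on {f \<in> \<F>. f p \<noteq> q} W2"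
    using normal[OF q(1) p q(2)] by blast
  have "normal_family_on ({f \<in> \<F>. f p \<noteq> p} \<union> {f \<in> \<F>. f p \<noteq> q}) (W1 \<inter> W2)"
    using W1(1) W2(1)
    by (intro normal_family_on_Un normal_family_on_mono[OF W1(4)] normal_family_on_mono[OF W2(3)])
       auto
  moreover have "\<F> \<subseteq> {f \<in> \<F>. f p \<noteq> p} \<union> {f \<in> \<F>. f p \<noteq> q}"
    using q(2) by auto
  ultimately have "normal_family_on \<F> (W1 \<inter> W2)"
    by (rule normal_family_on_subset)
  then have "normal_family_at D \<F> p"
    unfolding normal_family_at_def using W1 W2 e(2) by (intro exI[of _ "W1 \<inter> W2"]) auto
  then show False using p by (simp add: julia_set_def fatou_set_def)
qed

theorem theorem4p1:
  fixes D :: "complex set" and \<F> :: "(complex \<Rightarrow> complex) set"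
  assumes "open D" and "connected D" and "D \<noteq> {}"
    and "\<And>f. f \<in> \<F> \<Longrightarrow> f holomorphic_on D"
    and "forward_invariant \<F> (fatou_set D \<F>)"
    and "forward_invariant \<F> (julia_set D \<F>)"
  shows "topologically_transitive_on \<F> (julia_set D \<F>)"
proof -
  let ?J = "julia_set D \<F>"
  have "\<exists>f\<in>\<F>. f ` G \<inter> V \<noteq> {}"
    if G: "openin (top_of_set ?J) G" "G \<noteq> {}" and V: "openin (top_of_set ?J) V" "V \<noteq> {}" for G V
  proof (rule ccontr)
    assume "\<not> (\<exists>f\<in>\<F>. f ` G \<inter> V \<noteq> {})"
    then have miss: "f z \<notin> V" if "f \<in> \<F>" "z \<in> G" for f z
      using that by blast
    obtain A where A: "open A" "G = ?J \<inter> A" using G(1) openin_open by blast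
    obtain B where B: "open B" "V = ?J \<inter> B" using V(1) openin_open by blast
    obtain p where p: "p \<in> G" using G(2) by blast
    obtain a where a: "a \<in> V" using V(2) by blast
    \<comment> \<open>The empty family is normal everywhere, so a Julia point provides a member of \<open>\<F>\<close>.
       This member serves as the witness when the Julia set is a single point.\<close>
    have "\<F> \<noteq> {}"
    proof
      assume "\<F> = {}"
      then have "normal_family_on \<F> D" by (auto simp: normal_family_on_def)
      then have "normal_family_at D \<F> p"
        using p A(2) \<open>open D\<close> unfolding normal_family_at_def julia_set_def by blast
      then show False using p A(2) by (simp add: julia_set_def fatou_set_def)
    qed
    then obtain f0 where f0: "f0 \<in> \<F>" by blast
    have "V \<noteq> {a}"
    proof
      assume "V = {a}"
      then have "?J = {a}"
        using isolated_julia_point_unique[of D \<F> a B] assms(1,4,5) a B by auto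
      moreover have "f0 p \<in> ?J"
        using assms(6) f0 p A(2) unfolding forward_invariant_def by blast
      ultimately show False using miss[OF f0 p] a by simp
    qed
    then obtain b where b: "b \<in> V" "a \<noteq> b" using a by blast
    have "open (A \<inter> D)" "p \<in> A \<inter> D"
      using \<open>open D\<close> A p by (auto simp: julia_set_def)
    then obtain e where e: "e > 0" "ball p e \<subseteq> A \<inter> D"
      using open_contains_ball by blast
    have omit: "f z \<notin> V" if f: "f \<in> \<F>" and z: "z \<in> ball p e" for f z
    proof (cases "z \<in> ?J")
      case True
      then show ?thesis using miss[OF f] z e(2) A(2) by blast
    next
      case False
      then have "z \<in> fatou_set D \<F>" using z e(2) by (auto simp: julia_set_def)
      then have "f z \<in> fatou_set D \<F>"
        using assms(5) f unfolding forward_invariant_def by blast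
      then show ?thesis using B(2) by (simp add: julia_set_def)
    qed
    obtain W where "open W" "p \<in> W" "W \<subseteq> ball p e" "normal_family_on \<F> W"
    proof (rule normal_family_omit_once[of "ball p e" p a b \<F>])
      show "f holomorphic_on ball p e" if "f \<in> \<F>" for f
        using that assms(4) e(2) holomorphic_on_subset by blast
      show "a \<notin> f ` ball p e" if "f \<in> \<F>" for f
        using omit[OF that] a by blast
      show "x = y" if "f \<in> \<F>" "x \<in> ball p e" "y \<in> ball p e" "f x = b" "f y = b" for f x y
        using omit that b(1) by blast
    qed (use e(1) b(2) in \<open>auto simp: convex_imp_contractible\<close>)
    then have "normal_family_at D \<F> p"
      unfolding normal_family_at_def using e(2) by blast
    then show False using p A(2) by (simp add: julia_set_def fatou_set_def)
  qed
  then show ?thesis unfolding topologically_transitive_on_def by blast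
qed

end
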